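(* For every positive integer $n$, $\mathrm{HB}_4(n)\ge n-\sqrt{3n-3}-4$.
   Context: A partial word over an alphabet $A$ is a finite word over $A\cup\{\diamondsuit\}$, $\diamondsuit\notin A$ a hole symbol. Two partial words of equal length are compatible if they agree at every position where both have letters. A partial word is unbordered if no nonempty proper prefix is compatible with the proper suffix of the same length. $\mathrm{HB}_4(n)$ is the maximum number of holes an unbordered partial word of length $n$ over an alphabet of size $4$ can have. *)

theory Defs
  imports Complex_Main
begin

text \<open>A partial word is a list of options; the hole symbol is \<open>None\<close>.\<close>

type_synonym 'a pword = "'a option list"

definition pwords :: "'a set \<Rightarrow> nat \<Rightarrow> 'a pword set" where
  "pwords A n = {w. length w = n \<and> set w \<subseteq> insert None (Some ` A)}"

definition holes :: "'a pword \<Rightarrow> nat" where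
  "holes w = card {i. i < length w \<and> w ! i = None}"

definition compatible :: "'a pword \<Rightarrow> 'a pword \<Rightarrow> bool" where
  "compatible u v \<longleftrightarrow> length u = length v \<and>
     (\<forall>i < length u. u ! i \<noteq> None \<and> v ! i \<noteq> None \<longrightarrow> u ! i = v ! i)"

definition unbordered :: "'a pword \<Rightarrow> bool" where
  "unbordered w \<longleftrightarrow>
     (\<forall>k. 0 < k \<and> k < length w \<longrightarrow> \<not> compatible (take k w) (drop (length w - k) w))"

definition HB :: "'a set \<Rightarrow> nat \<Rightarrow> nat" where
  "HB A n = Max {holes w | w. w \<in> pwords A n \<and> unbordered w}"

text \<open>The set under \<open>Max\<close> is always finite, and it is nonempty as soon as the alphabet has
  two letters, so that \<open>HB\<close> is a genuine maximum there.\<close>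

lemma finite_hole_counts: "finite {holes w | w. w \<in> pwords A n \<and> unbordered w}"
proof (rule finite_subset)
  show "{holes w | w. w \<in> pwords A n \<and> unbordered w} \<subseteq> {..n}"
  proof clarsimp
    fix w :: "'a pword" assume "w \<in> pwords A n"
    then have "length w = n" by (simp add: pwords_def)
    moreover have "card {i. i < length w \<and> w ! i = None} \<le> card {..<length w}"
      by (rule card_mono) auto
    ultimately show "holes w \<le> n" by (simp add: holes_def)
  qed
qed simp

lemma hole_counts_nonempty:
  assumes "card A \<ge> 2"
  shows "{holes w | w. w \<in> pwords A n \<and> unbordered w} \<noteq> {}"
proof (cases n)
  case 0
  then have "[] \<in> pwords A n \<and> unbordered ([] :: 'a pword)"
    by (simp add: pwords_def unbordered_def)
  then show ?thesis by blast
next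
  case (Suc m)
  obtain B where B: "B \<subseteq> A" "card B = 2"
    using obtain_subset_with_card_n[OF assms] by metis
  then obtain a b where "B = {a, b}" "a \<noteq> b" by (auto simp: card_2_iff)
  with B have ab: "a \<in> A" "b \<in> A" "a \<noteq> b" by auto
  let ?w = "Some a # replicate m (Some b)"
  have "?w \<in> pwords A n"
    using ab Suc by (auto simp: pwords_def)
  moreover have "unbordered ?w"
    unfolding unbordered_def
  proof (intro allI impI notI)
    fix k assume k: "0 < k \<and> k < length ?w"
      and c: "compatible (take k ?w) (drop (length ?w - k) ?w)"
    have "take k ?w ! 0 = Some a" using k by simp
    moreover have "drop (length ?w - k) ?w ! 0 = Some b"
      using k by (auto simp: nth_Cons')
    moreover have "0 < length (take k ?w)" using k by simp
    ultimately show False using c ab unfolding compatible_def by (metis option.inject option.distinct(1))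
  qed
  ultimately show ?thesis by blast
qed

end

theory Submission
  imports Defs
begin

text \<open>
  A partial word of length \<open>N + 1\<close> is unbordered iff every distance in \<open>{1..N}\<close> is realised by two
  positions carrying distinct letters, so we need a complete sparse ruler of length \<open>N\<close> with few
  marks, together with a 4-colouring of the marks under which every distance still occurs between
  two colours. We take the Wichmann ruler with gaps
  \<open>1\<^sup>r, r+1, (2r+1)\<^sup>r, (4r+3)\<^sup>s, (2r+2)\<^sup>r\<^sup>+\<^sup>1, 1\<^sup>r\<close>. It has length
  \<open>L = 4r(r+s+2) + 3(s+1)\<close> and \<open>m = 4r+s+3\<close> marks, and \<open>m\<^sup>2 - 3L = (s-2r)\<^sup>2 - 3s\<close>, which is
  nonpositive for \<open>s\<close> near \<open>2r\<close>. Since the ruler starts with the \<open>r+1\<close> consecutive marks \<open>0..r\<close>,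
  each further mark placed at most \<open>r+1\<close> beyond its right end extends it; consecutive useful
  lengths differ by \<open>4r+3\<close>, so four such marks reach every \<open>N\<close>.
\<close>

section \<open>The marks of the ruler and their colours\<close>

text \<open>\<open>posC r\<close>, \<open>posE r s\<close> and \<open>posG r s\<close> are the marks at which the gaps \<open>4r+3\<close>, \<open>2r+2\<close> and
  the final gaps \<open>1\<close> begin.\<close>

definition posC :: "nat \<Rightarrow> nat" where
  "posC r = (r + 1) * (2 * r + 1)"

definition posE :: "nat \<Rightarrow> nat \<Rightarrow> nat" where
  "posE r s = posC r + s * (4 * r + 3)"

definition posG :: "nat \<Rightarrow> nat \<Rightarrow> nat" where
  "posG r s = posE r s + (r + 1) * (2 * r + 2)"

text \<open>\<open>None\<close> is a hole. \<open>posC r\<close> gets 1 so that it differs both from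
  the run before it (0) and from the two runs after it (2 and 3). The last coloured branch holds the
  extra marks: one every \<open>r + 1\<close> beyond the right end, up to \<open>N\<close>, and one
  at \<open>N\<close> itself.\<close>

definition colour :: "nat \<Rightarrow> nat \<Rightarrow> nat \<Rightarrow> nat \<Rightarrow> nat option" where
  "colour r s N p =
    (if p = 0 then Some 0
     else if p \<le> r then Some 1
     else if p < posC r then (if (2 * r + 1) dvd p then Some 0 else None)
     else if p = posC r then Some 1
     else if p \<le> posE r s then (if (4 * r + 3) dvd (p - posC r) then Some 2 else None)
     else if p \<le> posG r s then (if (2 * r + 2) dvd (p - posE r s) then Some 3 else None)
     else if p \<le> posG r s + r then Some 1
     else if p \<le> N \<and> (p = N \<or> (r + 1) dvd (p - (posG r s + r))) then Some 3
     else None)"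

definition separated :: "(nat \<Rightarrow> 'b option) \<Rightarrow> nat \<Rightarrow> bool" where
  "separated c d \<longleftrightarrow> (\<exists>p x y. c p = Some x \<and> c (p + d) = Some y \<and> x \<noteq> y)"

lemma separatedI:
  "c p = Some x \<Longrightarrow> c q = Some y \<Longrightarrow> x \<noteq> y \<Longrightarrow> q = p + d \<Longrightarrow> separated c d"
  unfolding separated_def by blast

lemma pos_order: "r < posC r \<and> posC r \<le> posE r s \<and> posE r s < posG r s"
  by (simp add: posC_def posE_def posG_def)

text \<open>The letters A, B, C, D, F in lemma names refer to the five runs of marks:
  \<open>{1..r}\<close>, gaps \<open>2r+1\<close>, gaps \<open>4r+3\<close>, gaps \<open>2r+2\<close>, and the final gaps \<open>1\<close>.\<close>

lemma colour_0: "colour r s N 0 = Some 0"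
  by (simp add: colour_def)

lemma colour_A: "1 \<le> u \<Longrightarrow> u \<le> r \<Longrightarrow> colour r s N u = Some 1"
  by (simp add: colour_def)

lemma colour_B:
  assumes "1 \<le> k" "k \<le> r"
  shows "colour r s N (k * (2 * r + 1)) = Some 0"
proof -
  have "r < 1 * (2 * r + 1)" by simp
  also have "\<dots> \<le> k * (2 * r + 1)" using assms by (intro mult_right_mono) auto
  finally have "r < k * (2 * r + 1)" .
  moreover have "k * (2 * r + 1) < posC r"
    unfolding posC_def using assms by (intro mult_strict_right_mono) auto
  ultimately show ?thesis by (simp add: colour_def del: mult_Suc_right)
qed

lemma colour_C0: "colour r s N (posC r) = Some 1"
  using pos_order[of r s] by (simp add: colour_def)

lemma colour_C:
  assumes "1 \<le> j" "j \<le> s"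
  shows "colour r s N (posC r + j * (4 * r + 3)) = Some 2"
proof -
  have "posC r + j * (4 * r + 3) \<le> posE r s"
    unfolding posE_def using assms by (intro add_left_mono mult_right_mono) auto
  moreover have "0 < j * (4 * r + 3)" using assms by simp
  ultimately show ?thesis
    using pos_order[of r s] by (simp add: colour_def del: mult_Suc_right)
qed

lemma colour_D:
  assumes "1 \<le> k" "k \<le> r + 1"
  shows "colour r s N (posE r s + k * (2 * r + 2)) = Some 3"
proof -
  have "posE r s + k * (2 * r + 2) \<le> posG r s"
    unfolding posG_def using assms by (intro add_left_mono mult_right_mono) auto
  moreover have "posE r s < posE r s + k * (2 * r + 2)" using assms by simp
  then have "r < posE r s + k * (2 * r + 2)" "posC r < posE r s + k * (2 * r + 2)"
    using pos_order[of r s] by (meson le_less_trans less_le_trans less_trans)+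
  ultimately show ?thesis
    using assms by (simp add: colour_def del: mult_Suc_right)
qed

lemma colour_G: "colour r s N (posG r s) = Some 3"
  using colour_D[of "r + 1" r s N] by (simp add: posG_def)

lemma colour_F: "1 \<le> t \<Longrightarrow> t \<le> r \<Longrightarrow> colour r s N (posG r s + t) = Some 1"
  using pos_order[of r s] by (simp add: colour_def)

lemma colour_extra:
  assumes "posG r s + r < p" "p \<le> N" "p = N \<or> (r + 1) dvd (p - (posG r s + r))"
  shows "colour r s N p = Some 3"
  using assms pos_order[of r s] by (simp add: colour_def)

section \<open>Realising every distance between two colours\<close>

lemma posC_split: "i \<le> r + 1 \<Longrightarrow> posC r = (r + 1 - i) * (2 * r + 1) + i * (2 * r + 1)"
  unfolding posC_def by (simp add: add_mult_distrib[symmetric] del: mult_Suc_right mult_Suc)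

lemma posE_split: "j \<le> s \<Longrightarrow> posE r s = (posC r + (s - j) * (4 * r + 3)) + j * (4 * r + 3)"
  unfolding posE_def by (simp add: add_mult_distrib[symmetric] del: mult_Suc_right mult_Suc)

lemma posG_split:
  "k \<le> r + 1 \<Longrightarrow> posG r s = (posE r s + (r + 1 - k) * (2 * r + 2)) + k * (2 * r + 2)"
  unfolding posG_def by (simp add: add_mult_distrib[symmetric] del: mult_Suc_right mult_Suc)

text \<open>The distance is a stretch of consecutive gaps: the last \<open>i\<close> of the gaps
  \<open>2r+1\<close>, then \<open>j\<close> gaps \<open>4r+3\<close>, then the first
  \<open>k\<close> gaps \<open>2r+2\<close>. A stretch meeting both outer runs contains the whole
  central run, hence the last assumption.\<close>

lemma separated_BCD:
  assumes "i \<le> r" "k \<le> r + 1" "j \<le> s" "i + j + k > 0"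
    and "i = 0 \<or> k = 0 \<or> j = s"
  shows "separated (colour r s N) (i * (2 * r + 1) + j * (4 * r + 3) + k * (2 * r + 2))"
    (is "separated ?c ?d")
proof (cases "k = 0")
  case True
  show ?thesis
  proof (cases "i = 0")
    case True
    show ?thesis
      by (rule separatedI[OF colour_C0 colour_C[of j s]]) (use True \<open>k = 0\<close> assms in auto)
  next
    case False
    have B: "?c ((r + 1 - i) * (2 * r + 1)) = Some 0"
      using False assms by (intro colour_B) auto
    show ?thesis
    proof (cases "j = 0")
      case True
      show ?thesis
        by (rule separatedI[OF B colour_C0]) (use True \<open>k = 0\<close> assms posC_split[of i r] in auto)
    next
      case False
      show ?thesis
        by (rule separatedI[OF B colour_C[of j s]])
          (use False \<open>k = 0\<close> assms posC_split[of i r] in auto)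
    qed
  qed
next
  case False
  then have D: "?c (posE r s + k * (2 * r + 2)) = Some 3"
    using assms by (intro colour_D) auto
  show ?thesis
  proof (cases "i = 0")
    case True
    have "\<exists>x. ?c (posC r + (s - j) * (4 * r + 3)) = Some x \<and> x \<noteq> 3"
      using colour_C0[of r s N] colour_C[of "s - j" s r N] by (cases "s - j = 0") auto
    then obtain x where x: "?c (posC r + (s - j) * (4 * r + 3)) = Some x" "x \<noteq> 3" by blast
    show ?thesis
      by (rule separatedI[OF x(1) D x(2)]) (use True assms posE_split[of j s r] in auto)
  next
    case False
    then have "j = s" using assms \<open>k \<noteq> 0\<close> by auto
    have B: "?c ((r + 1 - i) * (2 * r + 1)) = Some 0"
      using False assms by (intro colour_B) auto
    show ?thesis
      by (rule separatedI[OF B D])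
        (use \<open>j = s\<close> assms posC_split[of i r] in \<open>auto simp: posE_def\<close>)
  qed
qed

text \<open>Since \<open>(2r+1) + (2r+2) = 4r+3\<close>, pairs of one gap of each kind are traded for gaps of the
  central run, as many as that run can supply.\<close>

lemma separated_grid:
  assumes "p \<le> min (min p q) s + (r + 1)" "q \<le> min (min p q) s + r" "0 < p + q"
    and "d = p * (2 * r + 2) + q * (2 * r + 1)"
  shows "separated (colour r s N) d"
proof -
  define j where "j = min (min p q) s"
  obtain k i where p: "p = j + k" and q: "q = j + i"
    unfolding j_def by (metis le_add_diff_inverse min.cobounded1 min.cobounded2 min.coboundedI1)
  have "j = p \<or> j = q \<or> j = s" by (simp add: j_def min_def)
  then have "i = 0 \<or> k = 0 \<or> j = s" using p q by linarith
  moreover have "j \<le> s" by (simp add: j_def)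
  moreover have "k \<le> r + 1" "i \<le> r" using assms(1,2)[folded j_def] p q by linarith+
  ultimately have "separated (colour r s N) (i * (2 * r + 1) + j * (4 * r + 3) + k * (2 * r + 2))"
    using assms(3) p q by (intro separated_BCD) linarith+
  also have "i * (2 * r + 1) + j * (4 * r + 3) + k * (2 * r + 2) = d"
    unfolding assms(4) p q by (simp add: algebra_simps)
  finally show ?thesis .
qed

text \<open>With \<open>d = k(2r+1) + z\<close>, a small \<open>z\<close> is absorbed by enlarging
  \<open>z\<close> of the \<open>k\<close> gaps to \<open>2r+2\<close>; a medium one leads from the
  \<open>2r+2\<close> run into the final block; a large one leads from the initial block to the mark
  \<open>(k+1)(2r+1)\<close>.\<close>

lemma separated_low:
  assumes "0 < d" "d < posC r"
  shows "separated (colour r s N) d"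
proof -
  define k where "k = d div (2 * r + 1)"
  define z where "z = d mod (2 * r + 1)"
  have d: "d = k * (2 * r + 1) + z" unfolding k_def z_def by (rule div_mult_mod_eq[symmetric])
  have z: "z \<le> 2 * r" unfolding z_def by (simp add: less_Suc_eq_le[symmetric])
  have k: "k \<le> r"
    using assms(2) unfolding k_def posC_def
    by (simp add: less_mult_imp_div_less less_Suc_eq_le[symmetric])
  consider "z \<le> k" | "k < z" "z \<le> k + r" | "k + r < z" by linarith
  then show ?thesis
  proof cases
    case 1
    then obtain i where "k = z + i" by (auto simp: le_iff_add)
    then show ?thesis
      using d k assms(1) by (intro separated_grid[of z i]) (auto simp: algebra_simps)
  next
    case 2
    then obtain t where t: "z = k + t" "1 \<le> t" "t \<le> r"
      using that[of "z - k"] by linarith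
    show ?thesis
      by (rule separatedI[OF colour_D[of "r + 1 - k"] colour_F[of t]])
        (use k t d posG_split[of k r s] in \<open>auto simp: algebra_simps\<close>)
  next
    case 3
    have "k < r" using 3 z by linarith
    show ?thesis
      by (rule separatedI[OF colour_A[of "2 * r + 1 - z"] colour_B[of "k + 1"]])
        (use 3 z \<open>k < r\<close> d in \<open>auto simp: algebra_simps\<close>)
  qed
qed

lemma separated_mid:
  assumes "j < s" "x < 4 * r + 3" and d: "d = posC r + j * (4 * r + 3) + x"
  shows "separated (colour r s N) d"
proof -
  consider "x = 0" | "1 \<le> x" "x \<le> r" | "r + 1 \<le> x" "x \<le> 2 * r + 1"
    | "2 * r + 2 \<le> x" "x \<le> 3 * r + 2" | "3 * r + 3 \<le> x"
    by linarith
  then show ?thesis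
  proof cases
    case 1
    have "\<exists>y. colour r s N d = Some y \<and> y \<noteq> 0"
      using 1 d assms(1) colour_C0[of r s N] colour_C[of j s r N] by (cases "j = 0") auto
    then show ?thesis by (metis colour_0 separatedI add_0)
  next
    case 2
    then obtain i where i: "r = x + i" by (auto simp: le_iff_add)
    show ?thesis
      \<comment> \<open>Enlarging \<open>x\<close> of the \<open>r + 1\<close> gaps
        \<open>2r+1\<close> in \<open>posC r\<close> to \<open>2r+2\<close> adds exactly
        \<open>x\<close>.\<close>
      by (rule separated_grid[of "j + x" "j + i + 1"])
        (use 2 i d assms(1) in \<open>auto simp: algebra_simps min_def posC_def\<close>)
  next
    case 3
    then obtain t where t: "x = r + 1 + t" "t \<le> r" by (auto simp: le_iff_add)
    have C: "colour r s N (posC r + (s - j) * (4 * r + 3)) = Some 2"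
      using assms by (intro colour_C) auto
    have "\<exists>y. colour r s N (posG r s + t) = Some y \<and> y \<noteq> 2"
      using t colour_G[of r s N] colour_F[of t r s N] by (cases "t = 0") auto
    then obtain y where y: "colour r s N (posG r s + t) = Some y" "y \<noteq> 2" by blast
    show ?thesis
      by (rule separatedI[OF C y(1)])
        (use y t d assms(1) posE_split[of j s r] in \<open>auto simp: algebra_simps posG_def posC_def\<close>)
  next
    case 4
    then obtain y where y: "x = 2 * r + 2 + y" by (auto simp: le_iff_add)
    with 4 have "y \<le> r" by simp
    then obtain i where i: "r = y + i" by (auto simp: le_iff_add)
    show ?thesis
      \<comment> \<open>\<open>posC r + (2r+2) = (4r+3) + r(2r+1)\<close>: one more central gap, and
        \<open>y\<close> of the remaining \<open>r\<close> gaps are enlarged.\<close>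
      by (rule separated_grid[of "j + 1 + y" "j + 1 + i"])
        (use y i d assms(1) in \<open>auto simp: algebra_simps min_def posC_def\<close>)
  next
    case 5
    show ?thesis
      by (rule separatedI[OF colour_A[of "4 * r + 3 - x"] colour_C[of "j + 1" s]])
        (use 5 d assms in \<open>auto simp: algebra_simps\<close>)
  qed
qed

lemma colour_initial:
  assumes "u \<le> r"
  obtains x where "colour r s N u = Some x" "x = 0 \<or> x = 1"
  using assms colour_0[of r s N] colour_A[of u r s N] by (cases "u = 0") auto

lemma separated_high:
  assumes "posE r s \<le> d" "d \<le> posG r s + r"
  shows "separated (colour r s N) d"
proof -
  define x where "x = d - posE r s"
  define y where "y = x div (2 * r + 2)"
  define z where "z = x mod (2 * r + 2)"
  have x: "x = y * (2 * r + 2) + z" unfolding y_def z_def by (rule div_mult_mod_eq[symmetric])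
  have d: "d = posE r s + (y * (2 * r + 2) + z)" using assms x_def x by simp
  have z: "z \<le> 2 * r + 1" unfolding z_def by (simp add: less_Suc_eq_le[symmetric])
  have xle: "x \<le> (r + 1) * (2 * r + 2) + r" using assms by (simp add: x_def posG_def)
  then have "x < (r + 2) * (2 * r + 2)" by (simp add: algebra_simps)
  then have "y < r + 2" unfolding y_def by (rule less_mult_imp_div_less)
  then have y: "y \<le> r + 1" by simp
  consider "z = 0" "y = 0" | "z = 0" "y > 0" | "z > 0" "y = r + 1"
    | "z > 0" "y + z \<le> r + 1" | "y \<le> r" "z \<le> r + 1" "r + 1 < y + z" | "y \<le> r" "r + 1 < z"
    using y by linarith
  then show ?thesis
  proof cases
    case 1
    have "\<exists>v. colour r s N (posE r s) = Some v \<and> v \<noteq> 0"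
      using colour_C0[of r s N] colour_C[of s s r N] by (cases "s = 0") (auto simp: posE_def)
    then show ?thesis using 1 d by (metis colour_0 separatedI add_0 add_0_right mult_0)
  next
    case 2
    show ?thesis
      by (rule separatedI[OF colour_0 colour_D[of y]]) (use 2 y d in auto)
  next
    case 3
    then have "z \<le> r" using xle x by simp
    show ?thesis
      by (rule separatedI[OF colour_0 colour_F[of z]]) (use 3 \<open>z \<le> r\<close> d in \<open>auto simp: posG_def\<close>)
  next
    case 4
    then obtain b where b: "r + 1 = z + b" by (auto simp: le_iff_add)
    \<comment> \<open>The offset \<open>z\<close> comes from enlarging \<open>z\<close> of the gaps
      \<open>2r+1\<close> to \<open>2r+2\<close>.\<close>
    have "posE r s = b * (2 * r + 1) + z * (2 * r + 1) + s * (4 * r + 3)"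
      using posC_split[of z r] b by (simp add: posE_def)
    then show ?thesis
      by (intro separated_grid[of "s + (y + z)" "s + b"])
        (use 4 b d in \<open>auto simp: algebra_simps\<close>)
  next
    case 5
    \<comment> \<open>Moving the left end from 0 to \<open>k(2r+1)\<close> and the right end by
      \<open>k(2r+2)\<close>, up to \<open>posG r s\<close>, gains \<open>k\<close>; the final block
      supplies the other \<open>t\<close>.\<close>
    obtain k where k: "r + 1 = y + k" using y by (auto simp: le_iff_add)
    obtain t where t: "z = k + t" using 5 k by (metis add_less_cancel_left less_imp_add_positive)
    have G: "posG r s = (posE r s + y * (2 * r + 2)) + k * (2 * r + 2)"
      using posG_split[of k r s] k by simp
    show ?thesis
      by (rule separatedI[OF colour_B[of k] colour_F[of t]])
        (use 5 k t d G in \<open>auto simp: algebra_simps\<close>)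
  next
    case 6
    have u: "2 * r + 2 - z \<le> r" using 6 by linarith
    obtain v where v: "colour r s N (2 * r + 2 - z) = Some v" "v = 0 \<or> v = 1"
      using colour_initial[OF u] by blast
    show ?thesis
      by (rule separatedI[OF v(1) colour_D[of "y + 1"]])
        (use 6 z v(2) d in \<open>auto simp: algebra_simps\<close>)
  qed
qed

lemma separated_extra:
  assumes "posG r s + r < d" "d \<le> N"
  shows "separated (colour r s N) d"
proof -
  define L where "L = posG r s + r"
  \<comment> \<open>\<open>i\<close> is \<open>(d - L) / (r + 1)\<close> rounded up, so
    \<open>q\<close> is the first extra mark at or beyond \<open>d\<close>; it overshoots by at most
    \<open>r\<close>, which the initial block compensates.\<close>
  define i where "i = (d - L - 1) div (r + 1) + 1"
  define q where "q = min (L + i * (r + 1)) N"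
  define z where "z = (d - L - 1) mod (r + 1)"
  have "d - L - 1 = (d - L - 1) div (r + 1) * (r + 1) + z"
    unfolding z_def by (metis div_mult_mod_eq)
  then have e: "L + i * (r + 1) + z = d + r"
    using assms unfolding i_def L_def by (simp add: algebra_simps)
  have z: "z \<le> r" unfolding z_def by (simp add: less_Suc_eq_le[symmetric])
  have q: "d \<le> q" "q \<le> d + r" "q \<le> N" using e z assms q_def by auto
  have "q = N \<or> (r + 1) dvd (q - L)" unfolding q_def min_def by (simp del: mult_Suc_right)
  then have cq: "colour r s N q = Some 3"
    using q assms by (intro colour_extra) (auto simp: L_def)
  have "q - d \<le> r" using q by simp
  then obtain v where v: "colour r s N (q - d) = Some v" "v = 0 \<or> v = 1"
    using colour_initial by blast
  show ?thesis
    by (rule separatedI[OF v(1) cq]) (use q v(2) in auto)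
qed

lemma separated_all:
  assumes "0 < d" "d \<le> N"
  shows "separated (colour r s N) d"
proof -
  consider "d < posC r" | "posC r \<le> d" "d < posE r s" | "posE r s \<le> d" "d \<le> posG r s + r"
    | "posG r s + r < d"
    by linarith
  then show ?thesis
  proof cases
    case 1 then show ?thesis using assms separated_low by blast
  next
    case 2
    define j where "j = (d - posC r) div (4 * r + 3)"
    have "d - posC r < s * (4 * r + 3)" using 2 by (simp add: posE_def)
    then have "j < s" unfolding j_def by (rule less_mult_imp_div_less)
    moreover have "d = posC r + j * (4 * r + 3) + (d - posC r) mod (4 * r + 3)"
      using 2 unfolding j_def by (metis add.assoc div_mult_mod_eq le_add_diff_inverse)
    ultimately show ?thesis by (intro separated_mid[of j s]) auto
  next
    case 3 then show ?thesis by (rule separated_high)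
  next
    case 4 then show ?thesis using assms separated_extra by blast
  qed
qed

section \<open>Counting the marks\<close>

lemma colour_less_4: "colour r s N p = Some x \<Longrightarrow> x < 4"
  by (auto simp: colour_def split: if_splits)

lemma card_coloured:
  assumes "N \<le> posG r s + r + j * (r + 1)"
  shows "card {p. colour r s N p \<noteq> None} \<le> 4 * r + s + 3 + j"
proof -
  define S1 S2 S3 S4 S5 S6 where
    "S1 = {..r}" and
    "S2 = (\<lambda>k. k * (2 * r + 1)) ` {1..r}" and
    "S3 = (\<lambda>k. posC r + k * (4 * r + 3)) ` {..s}" and
    "S4 = (\<lambda>k. posE r s + k * (2 * r + 2)) ` {1..r + 1}" and
    "S5 = {posG r s<..posG r s + r}" and
    "S6 = (\<lambda>i. min (posG r s + r + i * (r + 1)) N) ` {1..j}"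
  note S = S1_def S2_def S3_def S4_def S5_def S6_def
  let ?U = "S1 \<union> S2 \<union> S3 \<union> S4 \<union> S5 \<union> S6"
  have sub: "{p. colour r s N p \<noteq> None} \<subseteq> ?U"
  proof
    fix p assume "p \<in> {p. colour r s N p \<noteq> None}"
    then have p: "colour r s N p \<noteq> None" by simp
    consider "p \<le> r" | "r < p" "p < posC r" | "p = posC r" | "posC r < p" "p \<le> posE r s"
      | "posE r s < p" "p \<le> posG r s" | "posG r s < p" "p \<le> posG r s + r"
      | "posG r s + r < p"
      by linarith
    then show "p \<in> ?U"
    proof cases
      case 1 then show ?thesis by (simp add: S1_def)
    next
      case 2
      then have "(2 * r + 1) dvd p" using p by (auto simp: colour_def split: if_splits)
      then obtain k where k: "p = k * (2 * r + 1)" by (metis dvd_def mult.commute)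
      with 2(2) have "k < r + 1" unfolding posC_def by (metis mult_less_cancel2)
      moreover have "k \<noteq> 0" using 2 k by (metis mult_0 not_less0)
      ultimately have "p \<in> S2" unfolding S2_def k by auto
      then show ?thesis by blast
    next
      case 3 then have "p \<in> S3" by (force simp: S3_def)
      then show ?thesis by blast
    next
      case 4
      then have "(4 * r + 3) dvd (p - posC r)"
        using p pos_order[of r s] by (auto simp: colour_def split: if_splits)
      then obtain k where k: "p - posC r = k * (4 * r + 3)" by (metis dvd_def mult.commute)
      then have "p = posC r + k * (4 * r + 3)" using 4 by linarith
      moreover have "k \<le> s"
        using 4 calculation
        by (metis (no_types) posE_def add_le_cancel_left mult_le_cancel2 add_gr_0 zero_less_numeral)
      ultimately have "p \<in> S3" by (auto simp: S3_def)
      then show ?thesis by blast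
    next
      case 5
      then have "(2 * r + 2) dvd (p - posE r s)"
        using p pos_order[of r s] by (auto simp: colour_def split: if_splits)
      then obtain k where k: "p - posE r s = k * (2 * r + 2)" by (metis dvd_def mult.commute)
      then have pk: "p = posE r s + k * (2 * r + 2)" using 5 by linarith
      then have "k \<le> r + 1"
        using 5
        by (metis (no_types) posG_def add_le_cancel_left mult_le_cancel2 add_gr_0 zero_less_numeral)
      moreover have "k \<noteq> 0" using 5 pk by (metis add_0_right mult_0 nat_less_le)
      ultimately have "p \<in> S4" unfolding S4_def pk by auto
      then show ?thesis by blast
    next
      case 6 then show ?thesis by (simp add: S5_def)
    next
      case 7
      then have p': "p \<le> N" "p = N \<or> (r + 1) dvd (p - (posG r s + r))"
        using p pos_order[of r s] by (auto simp: colour_def split: if_splits)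
      have "\<exists>i. p = min (posG r s + r + i * (r + 1)) N \<and> 1 \<le> i \<and> i \<le> j"
        using p'(2)
      proof
        assume "p = N"
        \<comment> \<open>The cap in \<open>S6\<close> makes \<open>N\<close> the image of
          \<open>j\<close>, so the mark at \<open>N\<close> costs nothing beyond the
          \<open>j\<close> extra marks.\<close>
        moreover have "j \<noteq> 0" using assms 7 \<open>p = N\<close> by (metis add_0_right mult_0 not_less)
        ultimately show ?thesis using assms by (intro exI[of _ j]) auto
      next
        assume "(r + 1) dvd (p - (posG r s + r))"
        then obtain i where "p - (posG r s + r) = i * (r + 1)" by (metis dvd_def mult.commute)
        then have i: "p = posG r s + r + i * (r + 1)" using 7 by linarith
        then have "i * (r + 1) \<le> j * (r + 1)" using p' assms by linarith
        then have "i \<le> j" by (metis add_gr_0 mult_le_cancel2 zero_less_one)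
        moreover have "i \<noteq> 0" using i 7 by (metis add_0_right mult_0 nat_less_le)
        ultimately show ?thesis using i p' by (intro exI[of _ i]) auto
      qed
      then have "p \<in> S6" by (auto simp: S6_def)
      then show ?thesis by blast
    qed
  qed
  have fin: "finite ?U" by (simp add: S)
  have "card {p. colour r s N p \<noteq> None} \<le> card ?U" using fin sub by (rule card_mono)
  also have "\<dots> \<le> card S1 + card S2 + card S3 + card S4 + card S5 + card S6"
    by (intro order_trans[OF card_Un_le] add_right_mono order_refl)
  also have "\<dots> \<le> (r + 1) + r + (s + 1) + (r + 1) + r + j"
  proof (intro add_mono)
    show "card S2 \<le> r" unfolding S2_def using card_image_le[of "{1..r}"] by force
    show "card S3 \<le> s + 1" unfolding S3_def using card_image_le[of "{..s}"] by force
    show "card S4 \<le> r + 1" unfolding S4_def using card_image_le[of "{1..r + 1}"] by force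
    show "card S6 \<le> j" unfolding S6_def using card_image_le[of "{1..j}"] by force
  qed (simp_all add: S1_def S5_def)
  finally show "card {p. colour r s N p \<noteq> None} \<le> 4 * r + s + 3 + j" by simp
qed

section \<open>From a colouring to a partial word\<close>

text \<open>A border of length \<open>k\<close> aligns \<open>p\<close> with
  \<open>p + (n - k)\<close>, so two distinct colours at distance \<open>n - k\<close> exclude it.
  Colours become letters through a bijection onto \<open>A\<close>.\<close>

lemma HB_ge_of_colouring:
  fixes A :: "'a set" and c :: "nat \<Rightarrow> nat option"
  assumes "finite A"
    and "\<And>p x. c p = Some x \<Longrightarrow> x < card A"
    and "\<And>p. c p \<noteq> None \<Longrightarrow> p < n"
    and "\<And>d. 0 < d \<Longrightarrow> d < n \<Longrightarrow> separated c d"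
    and "card {p. c p \<noteq> None} \<le> m"
  shows "n \<le> HB A n + m"
proof -
  obtain f where f: "bij_betw f {0..<card A} A"
    using assms(1) ex_bij_betw_nat_finite by blast
  define w where "w = map (\<lambda>p. map_option f (c p)) [0..<n]"
  have len: "length w = n" by (simp add: w_def)
  have nth: "w ! p = map_option f (c p)" if "p < n" for p using that by (simp add: w_def)
  have fA: "f x \<in> A" if "c p = Some x" for p x
    using that assms(2) f by (meson atLeastLessThan_iff bij_betw_apply zero_le)
  have "w \<in> pwords A n"
  proof -
    have "map_option f (c p) \<in> insert None (Some ` A)" for p
      using fA[of p] by (cases "c p") auto
    then show ?thesis by (auto simp: pwords_def w_def)
  qed
  moreover have "unbordered w"
    unfolding unbordered_def len
  proof (intro allI impI notI)
    fix k assume k: "0 < k \<and> k < n" and comp: "compatible (take k w) (drop (n - k) w)"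
    obtain p x y where c: "c p = Some x" "c (p + (n - k)) = Some y" "x \<noteq> y"
      using assms(4)[of "n - k"] k unfolding separated_def by auto
    have "p + (n - k) < n" using assms(3) c(2) by auto
    then have "p < k" using k by linarith
    then have "take k w ! p = Some (f x)" "drop (n - k) w ! p = Some (f y)"
      using k c \<open>p + (n - k) < n\<close> by (simp_all add: nth len add.commute)
    then have "f x = f y"
      using comp \<open>p < k\<close> k len unfolding compatible_def by auto
    moreover have "x < card A" "y < card A" using c assms(2) by blast+
    ultimately show False using c(3) f by (auto simp: bij_betw_def inj_on_def)
  qed
  ultimately have "holes w \<le> HB A n"
    unfolding HB_def by (intro Max_ge finite_hole_counts) blast
  moreover have "n = holes w + card {p. c p \<noteq> None}"
  proof -
    have "{p. c p \<noteq> None} \<subseteq> {..<n}" using assms(3) by auto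
    moreover have "{i. i < length w \<and> w ! i = None} = {..<n} - {p. c p \<noteq> None}"
      by (auto simp: len nth)
    ultimately show ?thesis
      unfolding holes_def
      by (metis card_Diff_subset card_lessThan card_mono finite_lessThan finite_subset le_add_diff_inverse2)
  qed
  ultimately show ?thesis using assms(5) by linarith
qed

section \<open>Choice of parameters and the final bound\<close>

lemma wichmann_length: "posG r s + r = 4 * r * (r + s + 2) + 3 * (s + 1)"
  by (simp add: posG_def posE_def posC_def algebra_simps)

lemma HB_ge_wichmann:
  fixes A :: "'a set"
  assumes "card A = 4" "posG r s + r \<le> N" "N \<le> posG r s + r + j * (r + 1)"
  shows "N + 1 \<le> HB A (N + 1) + (4 * r + s + 3 + j)"
proof (rule HB_ge_of_colouring[where c = "colour r s N"])
  show "finite A" using assms(1) card.infinite by fastforce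
  show "p < N + 1" if "colour r s N p \<noteq> None" for p
    using that assms(2) pos_order[of r s] by (auto simp: colour_def split: if_splits)
qed (use assms colour_less_4 separated_all card_coloured in auto)

text \<open>The number of marks is \<open>4r+s+3+j = (4r+s+j-1) + 4\<close>, so bounding the bracket
  by the square root of \<open>3N\<close>, where \<open>N = n - 1\<close>, gives the theorem. The
  integers keep the \<open>- 1\<close> from being truncated.\<close>

lemma wichmann_parameters:
  assumes "3 \<le> N"
  obtains r s j where "posG r s + r \<le> N" "N \<le> posG r s + r + j * (r + 1)"
    "(int (4 * r + s + j) - 1)\<^sup>2 \<le> 3 * int N"
proof (cases "N \<le> 27")
  case True
  \<comment> \<open>For \<open>r = 0\<close> the lengths are the multiples of 3, and extra marks
    advance by 1.\<close>
  define s where "s = (N - 3) div 3"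
  define j where "j = N mod 3"
  have N: "N = 3 * (s + 1) + j" using assms unfolding s_def j_def by presburger
  have "s \<le> 8" "j \<le> 2" using True N unfolding j_def by auto
  then have "s \<in> {0,1,2,3,4,5,6,7,8}" "j \<in> {0,1,2}" by auto
  then have "(int (4 * 0 + s + j) - 1)\<^sup>2 \<le> 3 * int N" unfolding N by auto
  moreover have "posG 0 s + 0 = 3 * (s + 1)" by (simp only: wichmann_length)
  ultimately show ?thesis using that[of 0 s j] N by simp
next
  case False
  txt \<open>The bound in \<open>P r\<close> is the length for parameters \<open>(r + 1, 2r)\<close>, which is also the length for
    \<open>(r, 2r + 4)\<close>; so for each \<open>r\<close> it suffices to let \<open>s\<close> range over \<open>2r - 2, \<dots>, 2r + 3\<close>.\<close>
  define P where "P r \<longleftrightarrow> N < 12 * (r + 1)\<^sup>2 + 6 * r + 3" for r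
  have "P N" by (simp add: P_def power2_eq_square)
  define r where "r = (LEAST r. P r)"
  have Pr: "P r" unfolding r_def using \<open>P N\<close> by (rule LeastI)
  have "r \<noteq> 0" using Pr False by (intro notI) (simp add: P_def)
  then obtain r' where r': "r = Suc r'" by (cases r) auto
  then have "\<not> P r'" unfolding r_def by (metis lessI not_less_Least r_def)
  define R where "R = 12 * r\<^sup>2 + 6 * r - 3"
  have R: "R + 3 = 12 * r\<^sup>2 + 6 * r" using r' by (simp add: R_def)
  have RN: "R \<le> N" using \<open>\<not> P r'\<close> R by (simp add: P_def r')
  \<comment> \<open>\<open>R\<close> is the length for \<open>(r, 2r - 2)\<close>, and each
    increment of \<open>s\<close> adds \<open>4r+3\<close>; \<open>e\<close> is the number of
    increments that fit below \<open>N\<close>.\<close>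
  define e where "e = (N - R) div (4 * r + 3)"
  define s where "s = 2 * r' + e"
  have len: "posG r s + r = R + e * (4 * r + 3)"
    using R unfolding wichmann_length s_def r' by (simp add: algebra_simps power2_eq_square)
  have "e * (4 * r + 3) \<le> N - R" unfolding e_def by simp
  then have 1: "posG r s + r \<le> N" using RN unfolding len by linarith
  have "N - R < e * (4 * r + 3) + (4 * r + 3)"
    unfolding e_def by (metis add.commute add_gr_0 dividend_less_div_times zero_less_numeral)
  then have 2: "N \<le> posG r s + r + 4 * (r + 1)"
    using RN unfolding len by (simp add: algebra_simps)
  have "N - R < 6 * (4 * r + 3)"
    using Pr R RN unfolding P_def by (simp add: algebra_simps power2_eq_square)
  then have "e < 6" unfolding e_def by (rule less_mult_imp_div_less)
  \<comment> \<open>\<open>r' = 0\<close> and \<open>e = 0\<close> would give \<open>s = 0\<close>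
    and the false bound \<open>4 \<le> 0\<close>; here \<open>R = 15\<close> with step 7, so
    \<open>N > 27\<close> rules this out.\<close>
  moreover have "e \<noteq> 0" if "r' = 0"
    using that False unfolding e_def R_def r' by simp
  ultimately have "(int e - 2)\<^sup>2 \<le> 3 * int s"
  proof -
    have "e \<in> {0,1,2,3,4,5}" using \<open>e < 6\<close> by auto
    then show ?thesis using \<open>r' = 0 \<Longrightarrow> e \<noteq> 0\<close> unfolding s_def by (cases "r' = 0") auto
  qed
  then have small: "(int e - 2)\<^sup>2 - 3 * int s \<le> 0" by simp
  \<comment> \<open>The identity \<open>m^2 - 3L = (s-2r)^2 - 3s\<close> with
    \<open>s - 2r = e - 2\<close>: for \<open>j = 4\<close> the squared term is exactly
    \<open>m = 4r+s+3\<close>.\<close>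
  have "(int (4 * r + s + 4) - 1)\<^sup>2 =
      3 * int (posG r s + r) + ((int e - 2)\<^sup>2 - 3 * int s)"
    unfolding wichmann_length s_def r' by (simp add: algebra_simps power2_eq_square)
  also have "\<dots> \<le> 3 * int (posG r s + r) + 0" using small by (rule add_left_mono)
  also have "\<dots> \<le> 3 * int N" using 1 by simp
  finally have "(int (4 * r + s + 4) - 1)\<^sup>2 \<le> 3 * int N" .
  then show ?thesis using that[OF 1 2] by blast
qed

theorem theorem9:
  fixes A :: "'a set" and n :: nat
  assumes "card A = 4" and "n \<ge> 1"
  shows "real (HB A n) \<ge> real n - sqrt (3 * real n - 3) - 4"
proof (cases "n \<le> 3")
  \<comment> \<open>Here \<open>n - 4\<close> is negative and the bound is trivial; otherwise
    \<open>N\<close> is at least 3, the shortest ruler length (\<open>r = s = 0\<close>).\<close>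
  case True
  have "0 \<le> sqrt (3 * real n - 3)" using assms(2) by simp
  then show ?thesis using True by linarith
next
  case False
  define N where "N = n - 1"
  have n: "n = N + 1" and "3 \<le> N" using False by (auto simp: N_def)
  obtain r s j where rsj: "posG r s + r \<le> N" "N \<le> posG r s + r + j * (r + 1)"
    "(int (4 * r + s + j) - 1)\<^sup>2 \<le> 3 * int N"
    using wichmann_parameters[OF \<open>3 \<le> N\<close>] by blast
  have "real_of_int ((int (4 * r + s + j) - 1)\<^sup>2) \<le> real_of_int (3 * int N)"
    using rsj(3) of_int_le_iff by blast
  then have "(real (4 * r + s + j) - 1)\<^sup>2 \<le> 3 * real N" by simp
  then have "real (4 * r + s + j) - 1 \<le> sqrt (3 * real N)" by (rule real_le_rsqrt)
  moreover have "real n \<le> real (HB A n) + real (4 * r + s + 3 + j)"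
    using HB_ge_wichmann[OF assms(1) rsj(1,2)] unfolding n by linarith
  ultimately show ?thesis unfolding n by simp
qed

end
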